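(* Let $E,F,G$ be cone-spaces and $r>0$. Let $A:F\to G$ and $B:E\to F$ be $r$-dominating linear maps. Then $A\circ B:E\to G$ is $r$-dominating and $$\rangle A\circ B\langle_r\;\le\;\rangle A\langle_r\cdot\rangle B\langle_r,\qquad \langle A\circ B\rangle_r\;\ge\;\langle A\rangle_r\cdot\langle B\rangle_r .$$
   Context: A cone-space is a finite-dimensional (real or complex) Banach space $E$ with two semi-norms, a contracting one $x\mapsto\;\rangle x\langle$ and an expanding one $x\mapsto\langle x\rangle$, such that $\max(\rangle x\langle,\langle x\rangle)$ is an equivalent norm on $E$. For $r>0$ put $|||x|||_r:=\max(\rangle x\langle,\,r\langle x\rangle)$ and define the $r$-contracting cone $\rangle E\langle_r:=\{x\in E:\;\rangle x\langle\;\ge r\langle x\rangle\}$ and the $r$-expanding cone $\langle E\rangle_r:=\{x\in E:\;\rangle x\langle\;\le r\langle x\rangle\}$. For a linear map $A:E\to F$ between cone-spaces (over the same field) let $$\rangle A\langle_r:=\inf\{R\ge 0: |||Ax|||_r\le R|||x|||_r\text{ for all }x\in E\text{ with }Ax\in\;\rangle F\langle_r\},$$ $$\langle A\rangle_r:=\sup\{R\ge 0: |||Ax|||_r\ge R|||x|||_r\text{ for all }x\in\langle E\rangle_r\}$$ (the supremum being $+\infty$ if unbounded). $A$ is called $r$-dominating if $\rangle A\langle_r<\langle A\rangle_r$. *)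

theory Defs
  imports "HOL-Analysis.Analysis"
begin

definition seminorm :: "('k::real_normed_field \<Rightarrow> 'e::ab_group_add \<Rightarrow> 'e) \<Rightarrow> ('e \<Rightarrow> real) \<Rightarrow> bool" where
  "seminorm s p \<longleftrightarrow>
     (\<forall>x. 0 \<le> p x) \<and> (\<forall>x y. p (x + y) \<le> p x + p y) \<and> (\<forall>c x. p (s c x) = norm c * p x)"

text \<open>
  The scalar type \<open>'k\<close> is any \<open>real_normed_field\<close>; its instances include \<open>real\<close> and \<open>complex\<close>,
  and by the Gelfand--Mazur theorem every instance is isomorphic to one of these two.
  The Banach space is the type \<open>'e :: banach\<close>; for \<open>'k = complex\<close> the complex structure is carried
  by \<open>scal\<close>, which has to be compatible with the real structure and the norm of \<open>'e\<close>.
\<close>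

record ('k, 'e) cone_structure =
  scal :: "'k \<Rightarrow> 'e \<Rightarrow> 'e"
  contr :: "'e \<Rightarrow> real"
  expan :: "'e \<Rightarrow> real"

locale cone_space = vector_space "scal E"
  for E :: "('k::real_normed_field, 'e::banach) cone_structure" +
  assumes scal_of_real: "scal E (of_real a) x = a *\<^sub>R x"
    and norm_scal: "norm (scal E c x) = norm c * norm x"
    and finite_dim: "\<exists>B. finite B \<and> module.span (scal E) B = UNIV"
    and seminorm_contr: "seminorm (scal E) (contr E)"
    and seminorm_expan: "seminorm (scal E) (expan E)"
    and equivalent_norm:
      "\<exists>m>0. \<exists>M>0. \<forall>x. m * norm x \<le> max (contr E x) (expan E x) \<and>
                          max (contr E x) (expan E x) \<le> M * norm x"

definition cone_norm :: "('k, 'e) cone_structure \<Rightarrow> real \<Rightarrow> 'e \<Rightarrow> real" where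
  "cone_norm E r x = max (contr E x) (r * expan E x)"

definition contr_cone :: "('k, 'e) cone_structure \<Rightarrow> real \<Rightarrow> 'e set" where
  "contr_cone E r = {x. contr E x \<ge> r * expan E x}"

definition expan_cone :: "('k, 'e) cone_structure \<Rightarrow> real \<Rightarrow> 'e set" where
  "expan_cone E r = {x. contr E x \<le> r * expan E x}"

text \<open>
  Both constants take values in \<open>[0, \<infinity>]\<close>. The first is finite for every linear map between
  cone-spaces, as such a map is bounded; the second is \<open>\<infinity>\<close> if the expanding cone is \<open>{0}\<close>.
\<close>

definition contr_const ::
  "('k, 'e) cone_structure \<Rightarrow> ('k, 'f) cone_structure \<Rightarrow> real \<Rightarrow> ('e \<Rightarrow> 'f) \<Rightarrow> ennreal" where
  "contr_const E F r A =
     Inf (ennreal ` {R. 0 \<le> R \<and>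
       (\<forall>x. A x \<in> contr_cone F r \<longrightarrow> cone_norm F r (A x) \<le> R * cone_norm E r x)})"

definition expan_const ::
  "('k, 'e) cone_structure \<Rightarrow> ('k, 'f) cone_structure \<Rightarrow> real \<Rightarrow> ('e \<Rightarrow> 'f) \<Rightarrow> ennreal" where
  "expan_const E F r A =
     Sup (ennreal ` {R. 0 \<le> R \<and>
       (\<forall>x\<in>expan_cone E r. cone_norm F r (A x) \<ge> R * cone_norm E r x)})"

definition dominating ::
  "('k, 'e) cone_structure \<Rightarrow> ('k, 'f) cone_structure \<Rightarrow> real \<Rightarrow> ('e \<Rightarrow> 'f) \<Rightarrow> bool" where
  "dominating E F r A \<longleftrightarrow> contr_const E F r A < expan_const E F r A"

end

theory Submission
  imports Defs
begin

text \<open>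
  If \<open>A\<close> is dominating, a nonzero vector of the expanding cone cannot be mapped into the contracting
  cone, since the two bounds on its image would contradict each other. So \<open>A\<close> preserves expanding
  cones and its preimage of the contracting cone lies in the contracting cone; hence the bounds that
  define the constants of \<open>A\<close> and \<open>B\<close> can be chained along \<open>A \<circ> B\<close>.
\<close>

definition contr_bounds ::
  "('k, 'e) cone_structure \<Rightarrow> ('k, 'f) cone_structure \<Rightarrow> real \<Rightarrow> ('e \<Rightarrow> 'f) \<Rightarrow> real set" where
  "contr_bounds E F r A =
     {R. 0 \<le> R \<and> (\<forall>x. A x \<in> contr_cone F r \<longrightarrow> cone_norm F r (A x) \<le> R * cone_norm E r x)}"

definition expan_bounds ::
  "('k, 'e) cone_structure \<Rightarrow> ('k, 'f) cone_structure \<Rightarrow> real \<Rightarrow> ('e \<Rightarrow> 'f) \<Rightarrow> real set" where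
  "expan_bounds E F r A =
     {R. 0 \<le> R \<and> (\<forall>x\<in>expan_cone E r. R * cone_norm E r x \<le> cone_norm F r (A x))}"

lemma contr_const_eq: "contr_const E F r A = (INF R\<in>contr_bounds E F r A. ennreal R)"
  by (simp add: contr_const_def contr_bounds_def)

lemma expan_const_eq: "expan_const E F r A = (SUP R\<in>expan_bounds E F r A. ennreal R)"
  by (simp add: expan_const_def expan_bounds_def)

text \<open>A strict inequality in \<open>ennreal\<close> has a finite left side. The finiteness is
  what later permits factors to move in and out of infima.\<close>

lemma contr_const_less_top:
  assumes "dominating E F r A"
  shows "contr_const E F r A < top"
  using assms unfolding dominating_def by (metis top_greatest less_le_trans)

text \<open>Multiplication by a finite constant is monotone and continuous from the right, hence
  commutes with infima of nonempty sets. For \<open>c = top\<close> this fails when positive values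
  have infimum 0, and for \<open>c = 0\<close> it fails on the empty set, whose infimum is
  \<open>top\<close>.\<close>

lemma INF_mult_left_ennreal:
  fixes c :: ennreal
  assumes "I \<noteq> {}" "c < top"
  shows "c * (INF i\<in>I. f i) = (INF i\<in>I. c * f i)"
proof -
  have "continuous (at_right (Inf (f ` I))) ((*) c)"
    unfolding continuous_within using assms(2) by (intro ennreal_tendsto_cmult tendsto_ident_at)
  then show ?thesis
    using assms(1) continuous_at_Inf_mono[of "(*) c" "f ` I"]
    by (simp add: mono_def mult_left_mono image_image)
qed

text \<open>The infima are taken one variable at a time: first over \<open>y\<close> with the finite
  factor \<open>f x\<close> fixed, then over \<open>x\<close> with the infimum of \<open>g\<close>
  as the finite factor.\<close>

lemma ennreal_le_mult_INF:
  fixes a :: ennreal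
  assumes le: "\<And>x y. x \<in> X \<Longrightarrow> y \<in> Y \<Longrightarrow> a \<le> f x * g y"
    and fin: "\<And>x. x \<in> X \<Longrightarrow> f x < top"
    and less_top: "(INF x\<in>X. f x) < top" "(INF y\<in>Y. g y) < top"
  shows "a \<le> (INF x\<in>X. f x) * (INF y\<in>Y. g y)"
proof -
  \<comment> \<open>The infimum over an empty set would be \<open>top\<close>.\<close>
  have ne: "X \<noteq> {}" "Y \<noteq> {}"
    using less_top by auto
  have "a \<le> f x * (INF y\<in>Y. g y)" if "x \<in> X" for x
    using that ne by (simp add: INF_mult_left_ennreal fin le INF_greatest)
  then have "a \<le> (INF x\<in>X. (INF y\<in>Y. g y) * f x)"
    by (simp add: mult.commute INF_greatest)
  then have "a \<le> (INF y\<in>Y. g y) * (INF x\<in>X. f x)"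
    using ne less_top by (simp add: INF_mult_left_ennreal)
  then show ?thesis
    by (simp add: mult.commute)
qed

lemma ennreal_mult_strict_mono:
  fixes a b c d :: ennreal
  assumes "a < c" "b < d"
  shows "a * b < c * d"
\<comment> \<open>Multiplying \<open>a < c\<close> by \<open>b\<close> stays strict only for
  \<open>b\<close> positive and finite; for \<open>b = 0\<close> the left side vanishes and both
  \<open>c\<close> and \<open>d\<close> are positive.\<close>
proof (cases "b = 0")
  case True
  then show ?thesis
    using assms by (auto simp: ennreal_zero_less_mult_iff intro: le_less_trans[OF zero_le])
next
  case False
  have "b < top"
    using assms(2) by (rule less_le_trans) simp
  then have "a * b < c * b"
    using assms(1) False by (simp add: ennreal_mult_strict_right_mono zero_less_iff_neq_zero)
  also have "\<dots> \<le> c * d"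
    using assms(2) by (simp add: mult_left_mono)
  finally show ?thesis .
qed

lemma (in cone_space) contr_zero: "contr E 0 = 0" and expan_zero: "expan E 0 = 0"
  using seminorm_contr seminorm_expan unfolding seminorm_def
  by (metis scale_zero_left norm_zero mult_zero_left)+

context
  fixes E :: "('k::real_normed_field, 'e::banach) cone_structure" and r :: real
  assumes E: "cone_space E" and r: "r > 0"
begin

text \<open>Norm equivalence makes one of the two semi-norms positive at \<open>x\<close>, and the
  weight \<open>r > 0\<close> preserves positivity.\<close>

lemma cone_norm_pos:
  assumes "x \<noteq> 0"
  shows "0 < cone_norm E r x"
proof -
  interpret cone_space E by (rule E)
  obtain m where m: "m > 0" "m * norm x \<le> max (contr E x) (expan E x)"
    using equivalent_norm by blast
  have "0 < m * norm x"
    using m(1) assms by simp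
  then have "0 < max (contr E x) (expan E x)"
    using m(2) by linarith
  then show ?thesis
    using r by (auto simp: cone_norm_def less_max_iff_disj)
qed

lemma dominating_eq_zero:
  fixes F :: "('k, 'f::banach) cone_structure"
  assumes "dominating E F r A" "x \<in> expan_cone E r" "A x \<in> contr_cone F r"
  shows "x = 0"
proof (rule ccontr)
  assume "x \<noteq> 0"
  \<comment> \<open>An infimum strictly below a supremum is witnessed by members of the two sets, so
    the contradiction is reached among real numbers.\<close>
  obtain R S where RS: "R \<in> contr_bounds E F r A" "S \<in> expan_bounds E F r A" "ennreal R < ennreal S"
    using assms(1) unfolding dominating_def contr_const_eq expan_const_eq
    by (auto simp: INF_less_iff less_SUP_iff)
  then have "R < S"
    by (simp add: contr_bounds_def expan_bounds_def ennreal_less_iff)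
  then have "R * cone_norm E r x < S * cone_norm E r x"
    using cone_norm_pos[OF \<open>x \<noteq> 0\<close>] by simp
  moreover have "S * cone_norm E r x \<le> R * cone_norm E r x"
    using RS assms unfolding contr_bounds_def expan_bounds_def by fastforce
  ultimately show False
    by simp
qed

text \<open>The two cones cover the space, so a counterexample would lie in the expanding cone and
  hence be zero; but zero belongs to both cones.\<close>

lemma dominating_contr_coneD:
  fixes F :: "('k, 'f::banach) cone_structure"
  assumes "dominating E F r A" "A x \<in> contr_cone F r"
  shows "x \<in> contr_cone E r"
proof (rule ccontr)
  assume x: "x \<notin> contr_cone E r"
  then have "x = 0"
    using assms by (intro dominating_eq_zero) (auto simp: contr_cone_def expan_cone_def)
  then show False
    using x by (simp add: contr_cone_def cone_space.contr_zero[OF E] cone_space.expan_zero[OF E])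
qed

end

text \<open>The covering argument is now applied to the image; linearity enters through
  \<open>A 0 = 0\<close>.\<close>

lemma dominating_expan_coneI:
  fixes E :: "('k::real_normed_field, 'e::banach) cone_structure"
    and F :: "('k, 'f::banach) cone_structure"
  assumes E: "cone_space E" and F: "cone_space F" and r: "r > 0"
    and A: "Vector_Spaces.linear (scal E) (scal F) A"
    and dom: "dominating E F r A" and x: "x \<in> expan_cone E r"
  shows "A x \<in> expan_cone F r"
proof (rule ccontr)
  assume Ax: "A x \<notin> expan_cone F r"
  then have "x = 0"
    using assms by (intro dominating_eq_zero[OF E r dom]) (auto simp: contr_cone_def expan_cone_def)
  then have "A x = 0"
    using A module_hom.zero module_hom_iff_linear by blast
  then show False
    using Ax by (simp add: expan_cone_def cone_space.contr_zero[OF F] cone_space.expan_zero[OF F])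
qed

theorem proposition2p9:
  fixes E :: "('k::real_normed_field, 'e::banach) cone_structure"
    and F :: "('k, 'f::banach) cone_structure"
    and G :: "('k, 'g::banach) cone_structure"
    and A :: "'f \<Rightarrow> 'g" and B :: "'e \<Rightarrow> 'f" and r :: real
  assumes "cone_space E" and "cone_space F" and "cone_space G"
    and "r > 0"
    and "Vector_Spaces.linear (scal F) (scal G) A"
    and "Vector_Spaces.linear (scal E) (scal F) B"
    and "dominating F G r A"
    and "dominating E F r B"
  shows "dominating E G r (A \<circ> B)
    \<and> contr_const E G r (A \<circ> B) \<le> contr_const F G r A * contr_const E F r B
    \<and> expan_const E G r (A \<circ> B) \<ge> expan_const F G r A * expan_const E F r B"
proof -
  note E = assms(1) and F = assms(2) and r = assms(4) and domA = assms(7) and domB = assms(8)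
  have "R * S \<in> contr_bounds E G r (A \<circ> B)"
    if R: "R \<in> contr_bounds F G r A" and S: "S \<in> contr_bounds E F r B" for R S
    unfolding contr_bounds_def mem_Collect_eq comp_apply
  proof (intro conjI allI impI)
    show "0 \<le> R * S"
      using R S by (simp add: contr_bounds_def)
    fix x assume ABx: "A (B x) \<in> contr_cone G r"
    \<comment> \<open>The bound \<open>S\<close> for \<open>B\<close> applies only if
      \<open>B x\<close> is in the contracting cone, which domination of \<open>A\<close>
      ensures.\<close>
    then have "B x \<in> contr_cone F r"
      by (rule dominating_contr_coneD[OF F r domA])
    then have "R * cone_norm F r (B x) \<le> R * (S * cone_norm E r x)"
      using R S by (intro mult_left_mono) (auto simp: contr_bounds_def)
    then show "cone_norm G r (A (B x)) \<le> R * S * cone_norm E r x"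
      using R ABx by (force simp: contr_bounds_def mult.assoc)
  qed
  then have contr: "contr_const E G r (A \<circ> B) \<le> contr_const F G r A * contr_const E F r B"
    using contr_const_less_top[OF domA] contr_const_less_top[OF domB]
    unfolding contr_const_eq
    by (intro ennreal_le_mult_INF)
      (auto simp: contr_bounds_def simp flip: ennreal_mult intro!: INF_lower)
  have "R * S \<in> expan_bounds E G r (A \<circ> B)"
    if R: "R \<in> expan_bounds F G r A" and S: "S \<in> expan_bounds E F r B" for R S
    unfolding expan_bounds_def mem_Collect_eq comp_apply
  proof (intro conjI ballI)
    show "0 \<le> R * S"
      using R S by (simp add: expan_bounds_def)
    fix x assume x: "x \<in> expan_cone E r"
    \<comment> \<open>Dually, domination of \<open>B\<close> puts \<open>B x\<close> where the lower
      bound \<open>R\<close> for \<open>A\<close> applies.\<close>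
    then have "B x \<in> expan_cone F r"
      by (rule dominating_expan_coneI[OF E F r assms(6) domB])
    moreover have "R * (S * cone_norm E r x) \<le> R * cone_norm F r (B x)"
      using R S x by (intro mult_left_mono) (auto simp: expan_bounds_def)
    ultimately show "R * S * cone_norm E r x \<le> cone_norm G r (A (B x))"
      using R by (force simp: expan_bounds_def mult.assoc)
  qed
  \<comment> \<open>Suprema in \<open>ennreal\<close> commute with every factor, so infinite
    expansion constants are covered.\<close>
  then have expan: "expan_const F G r A * expan_const E F r B \<le> expan_const E G r (A \<circ> B)"
    unfolding expan_const_eq SUP_mult_left_ennreal SUP_mult_right_ennreal
    by (intro SUP_least)
      (auto simp: expan_bounds_def simp flip: ennreal_mult intro!: SUP_upper)
  have "contr_const F G r A * contr_const E F r B < expan_const F G r A * expan_const E F r B"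
    using domA domB unfolding dominating_def by (intro ennreal_mult_strict_mono) auto
  with contr expan show ?thesis
    unfolding dominating_def by (meson le_less_trans less_le_trans)
qed

end
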